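(* Let $\mathcal{H}$ be a real Hilbert space and let $\{(x_i,y_i)\}_{i\in I}\subset\mathcal{H}\times\mathcal{H}$ be a set of vectors with (nonempty) index set $I$ such that \[ \|y_i-y_j\|\le\|x_i-x_j\|,\qquad\forall\, i,j\in I. \] Let $C$ be the closure of the convex hull of $\{x_i-y_i\}_{i\in I}$. (i) There exists a nonexpansive operator $\widetilde T\colon\mathcal{H}\to\mathcal{H}$ such that $y_i=\widetilde Tx_i$ for all $i\in I$, and $v=\Pi_C(0)$ is the infimal displacement vector of $\widetilde T$. (ii) If furthermore $v=x_\star-y_\star$ for some index $\star\in I$ and \[ \langle x_i-y_i,\,v\rangle\ge\|v\|^2,\qquad\forall\, i\in I, \] then there exists a nonexpansive operator $\widetilde T\colon\mathcal{H}\to\mathcal{H}$ such that $y_i=\widetilde Tx_i$ for all $i\in I$, and $v$ is the infimal displacement vector of $\widetilde T$.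
   Context: $\widetilde T\colon\mathcal{H}\to\mathcal{H}$ is nonexpansive if $\|\widetilde Tx-\widetilde Ty\|\le\|x-y\|$ for all $x,y\in\mathcal{H}$. $\Pi_C$ denotes the projection onto a nonempty closed convex set $C$. For nonexpansive $\widetilde T$, with $I_{\mathcal{H}}$ the identity operator and $\mathcal{R}(I_{\mathcal{H}}-\widetilde T)=\{x-\widetilde Tx:x\in\mathcal{H}\}$, the closure $\overline{\mathcal{R}(I_{\mathcal{H}}-\widetilde T)}$ is nonempty, closed and convex, and the infimal displacement vector of $\widetilde T$ is its unique minimum-norm element $\Pi_{\overline{\mathcal{R}(I_{\mathcal{H}}-\widetilde T)}}(0)$. In part (ii), $v$ denotes the vector $x_\star-y_\star$. *)

theory Defs
  imports "HOL-Analysis.Analysis"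
begin

text \<open>Real Hilbert spaces are types of sort \<open>{real_inner, complete_space}\<close>.\<close>

definition nonexpansive :: "('a::real_normed_vector \<Rightarrow> 'a) \<Rightarrow> bool" where
  "nonexpansive T \<longleftrightarrow> (\<forall>x y. norm (T x - T y) \<le> norm (x - y))"

text \<open>The library's \<^const>\<open>closest_point\<close> requires the sort \<open>heine_borel\<close>, hence finite
  dimension. The projection below is meaningful only for nonempty closed convex \<open>C\<close>; see
  \<open>projection_ex1\<close>.\<close>

definition projection :: "'a::real_inner set \<Rightarrow> 'a \<Rightarrow> 'a" where
  "projection C a = (THE p. p \<in> C \<and> (\<forall>z\<in>C. norm (a - p) \<le> norm (a - z)))"

text \<open>For nonexpansive \<open>T\<close> on a Hilbert space this is well defined; see
  \<open>closure_displacements_convex\<close>.\<close>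

definition infimal_displacement :: "('a::real_inner \<Rightarrow> 'a) \<Rightarrow> 'a" where
  "infimal_displacement T = projection (closure (range (\<lambda>x. x - T x))) 0"

lemma nonexpansive_iff_lipschitz: "nonexpansive T \<longleftrightarrow> 1-lipschitz_on UNIV T"
  by (simp add: nonexpansive_def lipschitz_on_def dist_norm)

lemma midpoint_estimate:
  fixes a p q :: "'a::real_inner"
  assumes C: "convex C" "p \<in> C" "q \<in> C" and d: "\<And>z. z \<in> C \<Longrightarrow> d \<le> norm (a - z)" "0 \<le> d"
  shows "(norm (p - q))\<^sup>2 \<le> 2 * (norm (a - p))\<^sup>2 + 2 * (norm (a - q))\<^sup>2 - 4 * d\<^sup>2"
proof -
  have "(1/2) *\<^sub>R p + (1/2) *\<^sub>R q \<in> C"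
    using C by (intro convexD) auto
  then have "d\<^sup>2 \<le> (norm (a - ((1/2) *\<^sub>R p + (1/2) *\<^sub>R q)))\<^sup>2"
    using d by (intro power_mono) auto
  moreover have "(norm (p - q))\<^sup>2 + 4 * (norm (a - ((1/2) *\<^sub>R p + (1/2) *\<^sub>R q)))\<^sup>2
      = 2 * (norm (a - p))\<^sup>2 + 2 * (norm (a - q))\<^sup>2"
    unfolding power2_norm_eq_inner
    by (simp add: inner_diff inner_add inner_commute algebra_simps)
  ultimately show ?thesis by linarith
qed

lemma projection_ex1:
  fixes C :: "'a::{real_inner,complete_space} set"
  assumes C: "closed C" "convex C" "C \<noteq> {}"
  shows "\<exists>!p. p \<in> C \<and> (\<forall>z\<in>C. norm (a - p) \<le> norm (a - z))"
proof (rule ex_ex1I)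
  define d where "d = Inf ((\<lambda>z. norm (a - z)) ` C)"
  have bdd: "bdd_below ((\<lambda>z. norm (a - z)) ` C)"
    by (rule bdd_belowI[of _ 0]) auto
  have lower: "d \<le> norm (a - z)" if "z \<in> C" for z
    unfolding d_def using bdd that by (simp add: cInf_lower)
  have d0: "0 \<le> d"
    unfolding d_def using C by (intro cInf_greatest) auto
  have "\<exists>z\<in>C. (norm (a - z))\<^sup>2 < d\<^sup>2 + 1 / (Suc n)" for n
  proof -
    have "d < sqrt (d\<^sup>2 + 1 / (Suc n))"
      using d0 by (intro real_less_rsqrt) auto
    then obtain z where z: "z \<in> C" "norm (a - z) < sqrt (d\<^sup>2 + 1 / (Suc n))"
      unfolding d_def using C bdd by (subst (asm) cInf_less_iff) auto
    then have "(norm (a - z))\<^sup>2 < (sqrt (d\<^sup>2 + 1 / (Suc n)))\<^sup>2"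
      by (intro power_strict_mono) auto
    with z show ?thesis by (intro bexI[of _ z]) auto
  qed
  then obtain s where s: "\<And>n. s n \<in> C" "\<And>n. (norm (a - s n))\<^sup>2 < d\<^sup>2 + 1 / (Suc n)"
    by metis
  have "Cauchy s"
  proof (rule metric_CauchyI)
    fix e :: real assume "e > 0"
    then obtain M where M: "1 / real (Suc M) < e\<^sup>2 / 4"
      using reals_Archimedean[of "e\<^sup>2 / 4"] by (auto simp: field_simps)
    have "dist (s m) (s n) < e" if "m \<ge> M" "n \<ge> M" for m n
    proof -
      have "1 / real (Suc m) \<le> 1 / real (Suc M)" "1 / real (Suc n) \<le> 1 / real (Suc M)"
        using that by (auto intro!: divide_left_mono)
      with M s(2)[of m] s(2)[of n] midpoint_estimate[OF C(2) s(1)[of m] s(1)[of n] lower d0]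
      have "(norm (s m - s n))\<^sup>2 < e\<^sup>2" by linarith
      with \<open>e > 0\<close> show ?thesis
        by (simp add: dist_norm power_less_imp_less_base)
    qed
    then show "\<exists>M. \<forall>m\<ge>M. \<forall>n\<ge>M. dist (s m) (s n) < e" by blast
  qed
  then obtain p where p: "s \<longlonglongrightarrow> p"
    using Cauchy_convergent convergent_def by blast
  have "p \<in> C"
    using closed_sequentially[OF C(1) s(1) p] .
  moreover have "(norm (a - p))\<^sup>2 \<le> d\<^sup>2"
  proof (rule LIMSEQ_le)
    show "(\<lambda>n. (norm (a - s n))\<^sup>2) \<longlonglongrightarrow> (norm (a - p))\<^sup>2"
      by (intro tendsto_intros p)
    show "(\<lambda>n. d\<^sup>2 + 1 / real (Suc n)) \<longlonglongrightarrow> d\<^sup>2"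
      using tendsto_add[OF tendsto_const LIMSEQ_inverse_real_of_nat, of "d\<^sup>2"]
      by (simp add: inverse_eq_divide)
  qed (use s(2) less_imp_le in blast)
  then have "norm (a - p) \<le> d"
    using d0 by (rule power2_le_imp_le)
  ultimately show "\<exists>p. p \<in> C \<and> (\<forall>z\<in>C. norm (a - p) \<le> norm (a - z))"
    using lower order_trans by blast
next
  fix p q
  assume p: "p \<in> C \<and> (\<forall>z\<in>C. norm (a - p) \<le> norm (a - z))"
    and q: "q \<in> C \<and> (\<forall>z\<in>C. norm (a - q) \<le> norm (a - z))"
  then have "norm (a - p) = norm (a - q)" by (simp add: order_antisym)
  with midpoint_estimate[of C p q "norm (a - p)" a] p q C(2)
  have "(norm (p - q))\<^sup>2 \<le> 0" by simp
  then show "p = q" by simp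
qed

lemma nonexpansive_monotone:
  fixes T :: "'a::real_inner \<Rightarrow> 'a"
  assumes "nonexpansive T"
  shows "0 \<le> (x - y) \<bullet> ((x - T x) - (y - T y))"
proof -
  have "(x - y) \<bullet> (T x - T y) \<le> norm (x - y) * norm (T x - T y)"
    by (rule norm_cauchy_schwarz)
  also have "\<dots> \<le> norm (x - y) * norm (x - y)"
    using assms by (intro mult_left_mono) (auto simp: nonexpansive_def)
  finally show ?thesis
    by (simp add: power2_norm_eq_inner flip: power2_eq_square)
       (simp add: inner_diff algebra_simps)
qed

lemma closure_displacements_convex:
  fixes T :: "'a::{real_inner,complete_space} \<Rightarrow> 'a"
  assumes T: "nonexpansive T"
  shows "convex (closure (range (\<lambda>x. x - T x)))"
proof -
  let ?A = "\<lambda>x. x - T x"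
  have seg: "u *\<^sub>R ?A a + w *\<^sub>R ?A b \<in> closure (range ?A)"
    if uw: "u \<ge> 0" "w \<ge> 0" "u + w = 1" for a b u w
  proof -
    define z where "z = u *\<^sub>R ?A a + w *\<^sub>R ?A b"
    define m where "m = u *\<^sub>R a + w *\<^sub>R b"
    define K where "K = - (u * (a \<bullet> (z - ?A a)) + w * (b \<bullet> (z - ?A b)))"
    have ex: "\<exists>x. x + e *\<^sub>R x - T x = z" if "e > 0" for e
    proof -
      have "\<exists>!x\<in>UNIV. (1 / (1 + e)) *\<^sub>R (z + T x) = x"
      proof (rule Banach_fix)
        show "dist ((1 / (1 + e)) *\<^sub>R (z + T x)) ((1 / (1 + e)) *\<^sub>R (z + T y))
            \<le> 1 / (1 + e) * dist x y" for x y
          using T that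
          by (simp add: dist_norm nonexpansive_def divide_right_mono flip: scaleR_diff_right)
      qed (use that in \<open>auto simp: complete_UNIV\<close>)
      then obtain x where "(1 / (1 + e)) *\<^sub>R (z + T x) = x" by auto
      then have "(1 + e) *\<^sub>R ((1 / (1 + e)) *\<^sub>R (z + T x)) = (1 + e) *\<^sub>R x" by simp
      then have "z + T x = (1 + e) *\<^sub>R x" using that by simp
      then show ?thesis by (intro exI[of _ x]) (simp add: algebra_simps)
    qed
    have key: "e * (x \<bullet> x) \<le> e * (m \<bullet> x) + K" if "x + e *\<^sub>R x - T x = z" for x e
    proof -
      have Ax: "?A x = z - e *\<^sub>R x" using that by (simp add: algebra_simps)
      have "0 \<le> u * ((x - a) \<bullet> (?A x - ?A a)) + w * ((x - b) \<bullet> (?A x - ?A b))"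
        using uw nonexpansive_monotone[OF T] by simp
      also have "\<dots> = (u + w) * (x \<bullet> z) - x \<bullet> z - e * ((u + w) * (x \<bullet> x)) + e * (m \<bullet> x) + K"
        unfolding Ax K_def m_def
        by (subst (4) z_def) (simp add: inner_diff inner_add inner_commute algebra_simps)
      finally show ?thesis using uw by simp
    qed
    show ?thesis
      unfolding z_def[symmetric] closure_approachable
    proof (intro allI impI)
      fix r :: real assume r: "r > 0"
      have "((\<lambda>e. e * (e * (norm m)\<^sup>2 + 2 * K)) \<longlongrightarrow> 0 * (0 * (norm m)\<^sup>2 + 2 * K)) (at_right 0)"
        by (intro tendsto_intros)
      then have "eventually (\<lambda>e. e * (e * (norm m)\<^sup>2 + 2 * K) < r\<^sup>2 \<and> e > 0) (at_right 0)"
        using r by (intro eventually_conj order_tendstoD(2)[where y = 0])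
          (auto simp: eventually_at_right_less)
      then obtain e :: real where e: "e * (e * (norm m)\<^sup>2 + 2 * K) < r\<^sup>2" "e > 0"
        using eventually_happens trivial_limit_at_right_real by blast
      obtain x where x: "x + e *\<^sub>R x - T x = z" using ex[OF e(2)] by blast
      have "2 * (m \<bullet> x) \<le> (norm m)\<^sup>2 + x \<bullet> x"
        using inner_ge_zero[of "m - x"]
        by (simp add: power2_norm_eq_inner inner_diff inner_commute)
      then have "e * (2 * (m \<bullet> x)) \<le> e * ((norm m)\<^sup>2 + x \<bullet> x)"
        using e by (intro mult_left_mono) auto
      with key[OF x] have "e * (x \<bullet> x) \<le> e * (norm m)\<^sup>2 + 2 * K"
        by (simp add: algebra_simps)
      then have "e * (e * (x \<bullet> x)) \<le> e * (e * (norm m)\<^sup>2 + 2 * K)"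
        using e by (intro mult_left_mono) auto
      moreover have "(norm (e *\<^sub>R x))\<^sup>2 = e * (e * (x \<bullet> x))"
        unfolding power2_norm_eq_inner by simp
      ultimately have "(norm (e *\<^sub>R x))\<^sup>2 < r\<^sup>2"
        using e by linarith
      then have "norm (e *\<^sub>R x) < r"
        using r by (simp only: power_less_imp_less_base order_less_imp_le)
      moreover have "dist (?A x) z = norm (e *\<^sub>R x)"
        unfolding dist_norm x[symmetric] by (subst norm_minus_commute) (simp add: algebra_simps)
      ultimately show "\<exists>y\<in>range ?A. dist y z < r"
        using \<open>norm (e *\<^sub>R x) < r\<close> by (intro bexI[of _ "?A x"]) simp_all
    qed
  qed
  show ?thesis
  proof (rule convexI)
    fix p q and u w :: real
    assume pq: "p \<in> closure (range ?A)" "q \<in> closure (range ?A)"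
      and uw: "0 \<le> u" "0 \<le> w" "u + w = 1"
    from pq obtain f g where f: "\<And>n. f n \<in> range ?A" "f \<longlonglongrightarrow> p"
      and g: "\<And>n. g n \<in> range ?A" "g \<longlonglongrightarrow> q"
      unfolding closure_sequential by metis
    show "u *\<^sub>R p + w *\<^sub>R q \<in> closure (range ?A)"
    proof (rule closed_sequentially[OF closed_closure])
      show "(\<lambda>n. u *\<^sub>R f n + w *\<^sub>R g n) \<longlonglongrightarrow> u *\<^sub>R p + w *\<^sub>R q"
        by (intro tendsto_intros f g)
      show "u *\<^sub>R f n + w *\<^sub>R g n \<in> closure (range ?A)" for n
        using f(1)[of n] g(1)[of n] seg[OF uw] by auto
    qed
  qed
qed

lemma infimal_displacement_ex1:
  fixes T :: "'a::{real_inner,complete_space} \<Rightarrow> 'a"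
  assumes "nonexpansive T"
  shows "\<exists>!v. v \<in> closure (range (\<lambda>x. x - T x))
           \<and> (\<forall>z\<in>closure (range (\<lambda>x. x - T x)). norm (0 - v) \<le> norm (0 - z))"
  using assms by (intro projection_ex1 closure_displacements_convex) auto

end

theory Submission
  imports Defs
begin

text \<open>
  Both parts follow from one extension theorem: a nonexpansive map on a set, all of whose
  displacements \<open>x - y\<close> lie in the half-space \<open>(x - y) \<bullet> v \<ge> \<parallel>v\<parallel>\<^sup>2\<close>, extends to a nonexpansive
  operator \<open>T\<close> on the whole Hilbert space with all displacements in that half-space
  (\<open>nonexpansive_extension\<close>). Every element of the half-space has norm at least \<open>\<parallel>v\<parallel>\<close>, so \<open>v\<close> is
  the infimal displacement vector of \<open>T\<close> as soon as \<open>v\<close> lies in the closure of the range of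
  \<open>I - T\<close>. That closure is convex and contains the prescribed displacements, hence contains \<open>C\<close>;
  and \<open>v \<in> C\<close> in both parts. In part (i), the half-space condition on the data is the
  variational inequality of the projection of 0 onto \<open>C\<close>; in part (ii) it is assumed.

  By Zorn's lemma it is enough to extend to one new point. After a translation this point
  is 0, and after adding \<open>v\<close> to the values the data \<open>x\<^sub>i \<mapsto> u\<^sub>i\<close> are nonexpansive with
  \<open>(x\<^sub>i - u\<^sub>i) \<bullet> v \<ge> 0\<close>. The value \<open>z\<close> sought has to satisfy \<open>\<parallel>z - u\<^sub>i\<parallel> \<le> \<parallel>x\<^sub>i\<parallel>\<close> for all \<open>i\<close>, as in
  Kirszbraun's theorem, and also \<open>z \<bullet> v \<le> 0\<close>. The half-space is a limit of balls: replacing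
  \<open>(x\<^sub>i, u\<^sub>i)\<close> by \<open>(x\<^sub>i - r v, u\<^sub>i - r v)\<close>, for all \<open>r \<ge> 0\<close>, while keeping the number
  \<open>c\<^sub>i = \<parallel>x\<^sub>i\<parallel>\<^sup>2 - \<parallel>u\<^sub>i\<parallel>\<^sup>2\<close>, gives a larger family of inequalities
  \<open>\<parallel>z\<parallel>\<^sup>2 - 2 (z \<bullet> (u\<^sub>i - r v)) \<le> c\<^sub>i\<close>, which for \<open>r = 0\<close> are the ball conditions and for
  \<open>r \<rightarrow> \<infinity>\<close> force \<open>z \<bullet> v \<le> 0\<close>. They say that the points \<open>(p, c)\<close> of the convex
  hull \<open>S\<close> of all \<open>(u\<^sub>i - r v, c\<^sub>i)\<close> satisfy \<open>\<parallel>z - p\<parallel>\<^sup>2 \<le> \<parallel>p\<parallel>\<^sup>2 + c\<close>. No compactness is needed to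
  find \<open>z\<close>: it is the limit of the first components of a sequence in \<open>S\<close> that minimises
  \<open>\<parallel>p\<parallel>\<^sup>2 + c\<close> (\<open>quadratic_support\<close>). This requires \<open>\<parallel>p\<parallel>\<^sup>2 + c \<ge> 0\<close> on \<open>S\<close>, which is where
  nonexpansiveness enters: in polarized form it is affine in each of two points and so passes
  from the data to their convex hull (\<open>polarized_bound_convex_hull\<close>).
\<close>

section \<open>A quadratic separation principle\<close>

lemma norm_convex_combination:
  fixes p q :: "'a::real_inner"
  shows "(norm ((1 - t) *\<^sub>R p + t *\<^sub>R q))\<^sup>2
    = (1 - t) * (norm p)\<^sup>2 + t * (norm q)\<^sup>2 - t * (1 - t) * (norm (p - q))\<^sup>2"
  unfolding power2_norm_eq_inner
  by (simp add: inner_add inner_diff inner_commute algebra_simps)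

text \<open>
  The functional \<open>\<parallel>p\<parallel>\<^sup>2 + c\<close> is strongly convex in \<open>p\<close>, so the first components of a minimising
  sequence are Cauchy, without any compactness of \<open>S\<close>; \<open>z\<close> is their
  limit. The conclusion is the first-order condition along this sequence, combined with the
  fact that the infimum is nonnegative.
\<close>

lemma quadratic_support:
  fixes S :: "('a::{real_inner,complete_space} \<times> real) set"
  assumes "convex S" and pos: "\<And>p c. (p, c) \<in> S \<Longrightarrow> 0 \<le> (norm p)\<^sup>2 + c"
  obtains z where "\<And>p c. (p, c) \<in> S \<Longrightarrow> (norm (z - p))\<^sup>2 \<le> (norm p)\<^sup>2 + c"
proof (cases "S = {}")
  case True
  then show ?thesis using that by auto
next
  case False
  define F where "F = (\<lambda>(p::'a, c::real). (norm p)\<^sup>2 + c)"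
  define m where "m = Inf (F ` S)"
  have bdd: "bdd_below (F ` S)"
    using pos by (intro bdd_belowI[of _ 0]) (auto simp: F_def)
  have lower: "m \<le> F w" if "w \<in> S" for w
    unfolding m_def using bdd that by (simp add: cInf_lower)
  have m0: "0 \<le> m"
    unfolding m_def using pos False by (intro cInf_greatest) (auto simp: F_def)
  have comb: "m \<le> (1 - t) * F w + t * F w' - t * (1 - t) * (norm (fst w - fst w'))\<^sup>2"
    if "w \<in> S" "w' \<in> S" "0 \<le> t" "t \<le> 1" for w w' t
  proof -
    have "(1 - t) *\<^sub>R w + t *\<^sub>R w' \<in> S"
      using \<open>convex S\<close> that by (intro convexD) auto
    from lower[OF this] have "m \<le> (norm ((1 - t) *\<^sub>R fst w + t *\<^sub>R fst w'))\<^sup>2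
        + ((1 - t) * snd w + t * snd w')"
      by (simp add: F_def case_prod_beta)
    then show ?thesis
      unfolding norm_convex_combination by (simp add: F_def case_prod_beta algebra_simps)
  qed
  have "\<exists>w\<in>S. F w < m + 1 / Suc n" for n
    using cInf_lessD[of "F ` S" "m + 1 / Suc n"] False unfolding m_def by auto
  then obtain s where s: "\<And>n. s n \<in> S" "\<And>n. F (s n) < m + 1 / Suc n"
    by metis
  have Fs: "(\<lambda>n. F (s n)) \<longlonglongrightarrow> m"
  proof (rule tendsto_sandwich)
    show "\<forall>\<^sub>F n in sequentially. m \<le> F (s n)"
      using lower s by simp
    show "\<forall>\<^sub>F n in sequentially. F (s n) \<le> m + 1 / real (Suc n)"
      by (intro always_eventually allI less_imp_le s)
    show "(\<lambda>n. m + 1 / real (Suc n)) \<longlonglongrightarrow> m"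
      using tendsto_add[OF tendsto_const LIMSEQ_inverse_real_of_nat, of m]
      by (simp add: inverse_eq_divide)
  qed simp
  have "Cauchy (\<lambda>n. fst (s n))"
  proof (rule metric_CauchyI)
    fix e :: real assume "e > 0"
    then have "\<forall>\<^sub>F n in sequentially. F (s n) < m + e\<^sup>2 / 4"
      by (intro order_tendstoD(2)[OF Fs]) auto
    then obtain M where M: "\<And>n. n \<ge> M \<Longrightarrow> F (s n) < m + e\<^sup>2 / 4"
      by (auto simp: eventually_sequentially)
    have "dist (fst (s k)) (fst (s n)) < e" if "k \<ge> M" "n \<ge> M" for k n
    proof -
      have "(norm (fst (s k) - fst (s n)))\<^sup>2 < e\<^sup>2"
        using comb[OF s(1)[of k] s(1)[of n], of "1/2"] M[OF that(1)] M[OF that(2)] by simp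
      then show ?thesis
        using \<open>e > 0\<close> by (simp add: dist_norm power_less_imp_less_base)
    qed
    then show "\<exists>M. \<forall>k\<ge>M. \<forall>n\<ge>M. dist (fst (s k)) (fst (s n)) < e" by blast
  qed
  then obtain z where z: "(\<lambda>n. fst (s n)) \<longlonglongrightarrow> z"
    using Cauchy_convergent convergent_def by blast
  show ?thesis
  proof (rule that)
    fix p c assume pc: "(p, c) \<in> S"
    \<comment> \<open>Compare the infimum with the value a fraction \<open>t\<close> of the way from \<open>s n\<close> to \<open>(p, c)\<close>,
      first for \<open>n \<rightarrow> \<infinity>\<close> and then for \<open>t \<rightarrow> 0\<close>.\<close>
    have "(1 - t) * (norm (z - p))\<^sup>2 \<le> F (p, c)" if t: "0 < t" "t \<le> 1" for t
    proof -
      have "m \<le> (1 - t) * m + t * F (p, c) - t * (1 - t) * (norm (z - fst (p, c)))\<^sup>2"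
      proof (rule LIMSEQ_le_const)
        show "(\<lambda>n. (1 - t) * F (s n) + t * F (p, c)
                 - t * (1 - t) * (norm (fst (s n) - fst (p, c)))\<^sup>2)
          \<longlonglongrightarrow> (1 - t) * m + t * F (p, c) - t * (1 - t) * (norm (z - fst (p, c)))\<^sup>2"
          by (intro tendsto_intros Fs z)
      qed (use comb[OF s(1) pc] t in \<open>simp add: less_imp_le\<close>)
      then have "t * (m + (1 - t) * (norm (z - p))\<^sup>2) \<le> t * F (p, c)"
        by (simp add: algebra_simps)
      with t m0 show ?thesis by simp
    qed
    then have "\<forall>\<^sub>F t in at_right 0. (1 - t) * (norm (z - p))\<^sup>2 \<le> F (p, c)"
      by (auto simp: eventually_at_right_field intro!: exI[of _ 1])
    moreover have "((\<lambda>t. (1 - t) * (norm (z - p))\<^sup>2) \<longlongrightarrow> (1 - 0) * (norm (z - p))\<^sup>2) (at_right 0)"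
      by (intro tendsto_intros)
    ultimately have "(1 - 0) * (norm (z - p))\<^sup>2 \<le> F (p, c)"
      by (intro tendsto_upperbound) auto
    then show "(norm (z - p))\<^sup>2 \<le> (norm p)\<^sup>2 + c"
      by (simp add: F_def)
  qed
qed

text \<open>
  The set of \<open>(a, b, c)\<close> satisfying the conclusion is in general not convex. The polarized hypothesis,
  however, is affine in each of its two points, so each point can be moved in turn from \<open>G\<close> to
  the hull; the conclusion is the diagonal case.
\<close>

lemma polarized_bound_convex_hull:
  fixes G :: "('a::real_inner \<times> 'b::real_inner \<times> real) set"
  assumes pair: "\<And>a b c a' b' c'. (a, b, c) \<in> G \<Longrightarrow> (a', b', c') \<in> G \<Longrightarrow>
      2 * (a \<bullet> a') - 2 * (b \<bullet> b') \<le> c + c'"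
    and hull: "(a, b, c) \<in> convex hull G"
  shows "(norm a)\<^sup>2 - (norm b)\<^sup>2 \<le> c"
proof -
  define N where "N = (\<lambda>(a::'a, b::'b, c::real). {(a', b', c'::real).
      2 * (a \<bullet> a') - 2 * (b \<bullet> b') \<le> c + c'})"
  have N: "convex (N w)" for w
  proof -
    obtain a b c where w: "w = (a, b, c)" by (cases w)
    have "N w = {q. (2 *\<^sub>R a, - 2 *\<^sub>R b, - 1) \<bullet> q \<le> c}"
      by (auto simp: N_def w)
    then show ?thesis by (simp add: convex_halfspace_le)
  qed
  have sym: "q \<in> N w \<longleftrightarrow> w \<in> N q" for q w
    by (auto simp: N_def inner_commute split: prod.splits)
  have 1: "convex hull G \<subseteq> N w" if "w \<in> G" for w
    using pair that N by (intro hull_minimal) (auto simp: N_def)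
  have "convex hull G \<subseteq> N q" if "q \<in> convex hull G" for q
    using 1 that N sym by (intro hull_minimal) blast+
  from this[OF hull] hull have "(a, b, c) \<in> N (a, b, c)" by blast
  then show ?thesis by (simp add: N_def power2_norm_eq_inner)
qed

section \<open>Extension with a prescribed displacement half-space\<close>

text \<open>
  Partial nonexpansive maps are represented by their graphs, so that Zorn's lemma applies to
  inclusion; the first condition makes such a relation single-valued.
\<close>

definition displacement_graph :: "'a::real_inner \<Rightarrow> ('a \<times> 'a) set \<Rightarrow> bool" where
  "displacement_graph v G \<longleftrightarrow>
     (\<forall>(x, y)\<in>G. \<forall>(x', y')\<in>G. norm (y - y') \<le> norm (x - x')) \<and>
     (\<forall>(x, y)\<in>G. (norm v)\<^sup>2 \<le> (x - y) \<bullet> v)"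

text \<open>
  Kirszbraun's one-point extension with the additional half-space constraint on the new value.
  In \<open>g\<close> below, the origin is moved to \<open>x\<^sub>0\<close>, the values are shifted by \<open>v\<close>, and the translates by
  \<open>- r *\<^sub>R v\<close> encode the half-space.
\<close>

lemma one_point_extension:
  fixes v x\<^sub>0 :: "'a::{real_inner,complete_space}"
  assumes "displacement_graph v G"
  obtains y\<^sub>0 where "displacement_graph v (insert (x\<^sub>0, y\<^sub>0) G)"
proof (cases "G = {}")
  case True
  have "displacement_graph v (insert (x\<^sub>0, x\<^sub>0 - v) G)"
    by (simp add: displacement_graph_def True power2_norm_eq_inner)
  then show ?thesis by (rule that)
next
  case False
  have ne: "norm (y - y') \<le> norm (x - x')" if "(x, y) \<in> G" "(x', y') \<in> G" for x y x' y'
    using assms that unfolding displacement_graph_def by blast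
  have hs: "(norm v)\<^sup>2 \<le> (x - y) \<bullet> v" if "(x, y) \<in> G" for x y
    using assms that unfolding displacement_graph_def by blast
  define g where "g = (\<lambda>(x, y) r. (x - x\<^sub>0 - r *\<^sub>R v, y + v - x\<^sub>0 - r *\<^sub>R v,
      (norm (x - x\<^sub>0))\<^sup>2 - (norm (y + v - x\<^sub>0))\<^sup>2))"
  define W where "W = {g w r |w r. w \<in> G \<and> 0 \<le> r}"
  have pair: "2 * (a \<bullet> a') - 2 * (b \<bullet> b') \<le> c + c'"
    if w: "(a, b, c) \<in> W" "(a', b', c') \<in> W" for a b c a' b' c'
  proof -
    obtain x y r where 1: "(x, y) \<in> G" "0 \<le> r" "(a, b, c) = g (x, y) r"
      using w(1) unfolding W_def by auto
    obtain x' y' r' where 2: "(x', y') \<in> G" "0 \<le> r'" "(a', b', c') = g (x', y') r'"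
      using w(2) unfolding W_def by auto
    \<comment> \<open>In the polarized inequality the terms with \<open>r * r'\<close> cancel; those linear in \<open>r\<close> and \<open>r'\<close>
      have the right sign because \<open>d\<close> and \<open>d'\<close> have nonnegative inner product with \<open>v\<close>.\<close>
    define d d' where "d = x - y - v" and "d' = x' - y' - v"
    have y: "y = x - d - v" "y' = x' - d' - v" by (simp_all add: d_def d'_def)
    have "0 \<le> d \<bullet> v" "0 \<le> d' \<bullet> v"
      using hs[OF 1(1)] hs[OF 2(1)]
      by (simp_all add: d_def d'_def inner_diff_left power2_norm_eq_inner)
    then have nonneg: "0 \<le> r' * (d \<bullet> v)" "0 \<le> r * (d' \<bullet> v)"
      using 1(2) 2(2) by simp_all
    have norms: "(norm (y - y'))\<^sup>2 \<le> (norm (x - x'))\<^sup>2"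
      using ne[OF 1(1) 2(1)] by (simp add: power_mono)
    have abc: "a = x - x\<^sub>0 - r *\<^sub>R v" "b = x - x\<^sub>0 - d - r *\<^sub>R v"
        "c = (norm (x - x\<^sub>0))\<^sup>2 - (norm (x - x\<^sub>0 - d))\<^sup>2"
        "a' = x' - x\<^sub>0 - r' *\<^sub>R v" "b' = x' - x\<^sub>0 - d' - r' *\<^sub>R v"
        "c' = (norm (x' - x\<^sub>0))\<^sup>2 - (norm (x' - x\<^sub>0 - d'))\<^sup>2"
      using 1(3) 2(3) by (simp_all add: g_def y algebra_simps)
    show ?thesis
      using nonneg norms unfolding abc y power2_norm_eq_inner
      by (simp add: inner_add inner_diff inner_commute algebra_simps)
  qed
  have "convex (snd ` (convex hull W))"
    by (intro convex_linear_image linear_snd convex_convex_hull)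
  moreover have "0 \<le> (norm b)\<^sup>2 + c" if "(b, c) \<in> snd ` (convex hull W)" for b c
  proof -
    from that obtain a where "(a, b, c) \<in> convex hull W" by auto
    from polarized_bound_convex_hull[OF pair this] show ?thesis
      using zero_le_power2[of "norm a"] by linarith
  qed
  ultimately obtain z
    where z: "\<And>b c. (b, c) \<in> snd ` (convex hull W) \<Longrightarrow> (norm (z - b))\<^sup>2 \<le> (norm b)\<^sup>2 + c"
    using quadratic_support by metis
  have key: "(norm (z - (y + v - x\<^sub>0)))\<^sup>2 + 2 * r * (z \<bullet> v) \<le> (norm (x - x\<^sub>0))\<^sup>2"
    if "(x, y) \<in> G" "0 \<le> r" for x y r
  proof -
    have "g (x, y) r \<in> convex hull W"
      using that by (intro hull_inc) (auto simp: W_def)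
    then have "snd (g (x, y) r) \<in> snd ` (convex hull W)" by blast
    from z[OF this[unfolded g_def, simplified]] show ?thesis
      unfolding power2_norm_eq_inner
      by (simp add: inner_add inner_diff inner_commute algebra_simps)
  qed
  have zv: "z \<bullet> v \<le> 0"
  proof (rule ccontr)
    assume *: "\<not> z \<bullet> v \<le> 0"
    obtain x y where xy: "(x, y) \<in> G" using False by auto
    \<comment> \<open>The left-hand side of \<open>key\<close> grows linearly in \<open>r\<close>; this \<open>r\<close> already exceeds the bound.\<close>
    define r where "r = ((norm (x - x\<^sub>0))\<^sup>2 + 1) / (2 * (z \<bullet> v))"
    have "0 \<le> r" "2 * r * (z \<bullet> v) = (norm (x - x\<^sub>0))\<^sup>2 + 1"
      using * by (simp_all add: r_def)
    with key[OF xy \<open>0 \<le> r\<close>] zero_le_power2[of "norm (z - (y + v - x\<^sub>0))"]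
    show False by linarith
  qed
  have near: "norm (z + x\<^sub>0 - v - y) \<le> norm (x\<^sub>0 - x)" if "(x, y) \<in> G" for x y
  proof -
    have "norm (z - (y + v - x\<^sub>0)) \<le> norm (x - x\<^sub>0)"
      using key[OF that, of 0] by (intro power2_le_imp_le[OF _ norm_ge_zero]) linarith
    moreover have "z + x\<^sub>0 - v - y = z - (y + v - x\<^sub>0)" by (simp add: algebra_simps)
    ultimately show ?thesis by (simp only: norm_minus_commute[of x])
  qed
  then have near': "norm (y - (z + x\<^sub>0 - v)) \<le> norm (x - x\<^sub>0)" if "(x, y) \<in> G" for x y
    using that by (simp only: norm_minus_commute[of y] norm_minus_commute[of x])
  have new: "(norm v)\<^sup>2 \<le> (x\<^sub>0 - (z + x\<^sub>0 - v)) \<bullet> v"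
    using zv by (simp add: inner_diff_left inner_add_left power2_norm_eq_inner)
  have "displacement_graph v (insert (x\<^sub>0, z + x\<^sub>0 - v) G)"
    unfolding displacement_graph_def by (auto intro: ne hs near near' new[simplified])
  then show ?thesis by (rule that)
qed

lemma nonexpansive_extension:
  fixes v :: "'a::{real_inner,complete_space}"
  assumes "displacement_graph v G"
  obtains T where "nonexpansive T" "\<And>x y. (x, y) \<in> G \<Longrightarrow> T x = y"
    "\<And>x. (norm v)\<^sup>2 \<le> (x - T x) \<bullet> v"
proof -
  define E where "E = {H. G \<subseteq> H \<and> displacement_graph v H}"
  have "\<exists>M\<in>E. \<forall>H\<in>E. M \<subseteq> H \<longrightarrow> H = M"
  proof (rule subset_Zorn_nonempty)
    show "E \<noteq> {}" using assms by (auto simp: E_def)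
    fix K assume K: "K \<noteq> {}" "subset.chain E K"
    have "\<exists>H\<in>K. p \<in> H \<and> q \<in> H" if "p \<in> \<Union>K" "q \<in> \<Union>K" for p q
      using K(2) that unfolding subset_chain_def by blast
    moreover have "displacement_graph v H" if "H \<in> K" for H
      using K(2) that unfolding subset_chain_def E_def by blast
    ultimately have common: "\<exists>H. displacement_graph v H \<and> p \<in> H \<and> q \<in> H"
      if "p \<in> \<Union>K" "q \<in> \<Union>K" for p q
      using that by meson
    have "displacement_graph v (\<Union>K)"
      unfolding displacement_graph_def
    proof safe
      fix x y x' y' L L' assume "L \<in> K" "(x, y) \<in> L" "L' \<in> K" "(x', y') \<in> L'"
      then obtain H where "displacement_graph v H" "(x, y) \<in> H" "(x', y') \<in> H"
        using common[of "(x, y)" "(x', y')"] by blast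
      then show "norm (y - y') \<le> norm (x - x')"
        unfolding displacement_graph_def by blast
    next
      fix x y L assume "L \<in> K" "(x, y) \<in> L"
      then obtain H where "displacement_graph v H" "(x, y) \<in> H"
        using common[of "(x, y)" "(x, y)"] by blast
      then show "(norm v)\<^sup>2 \<le> (x - y) \<bullet> v"
        unfolding displacement_graph_def by blast
    qed
    moreover have "G \<subseteq> \<Union>K"
      using K unfolding subset_chain_def E_def by blast
    ultimately show "\<Union>K \<in> E" by (simp add: E_def)
  qed
  then obtain M where M: "G \<subseteq> M" "displacement_graph v M"
    and max: "\<And>H. displacement_graph v H \<Longrightarrow> M \<subseteq> H \<Longrightarrow> H = M"
    unfolding E_def by auto
  have "\<exists>y. (x, y) \<in> M" for x
    using one_point_extension[OF M(2), of x] max by (metis insertI1 subset_insertI)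
  then obtain T where T: "\<And>x. (x, T x) \<in> M" by metis
  have ne: "norm (y - y') \<le> norm (x - x')" if "(x, y) \<in> M" "(x', y') \<in> M" for x y x' y'
    using M(2) that unfolding displacement_graph_def by blast
  show ?thesis
  proof (rule that)
    show "nonexpansive T" using ne T by (auto simp: nonexpansive_def)
    show "T x = y" if "(x, y) \<in> G" for x y
      using ne[OF T[of x], of x y] M(1) that by auto
    show "(norm v)\<^sup>2 \<le> (x - T x) \<bullet> v" for x
      using M(2) T unfolding displacement_graph_def by blast
  qed
qed

section \<open>Identification of the infimal displacement vector\<close>

lemma infimal_displacement_eqI:
  fixes T :: "'a::{real_inner,complete_space} \<Rightarrow> 'a"
  assumes T: "nonexpansive T" and v: "v \<in> closure (range (\<lambda>x. x - T x))"
    and hs: "\<And>x. (norm v)\<^sup>2 \<le> (x - T x) \<bullet> v"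
  shows "infimal_displacement T = v"
proof -
  have "closure (range (\<lambda>x. x - T x)) \<subseteq> {z. v \<bullet> z \<ge> (norm v)\<^sup>2}"
    using hs by (intro closure_minimal closed_halfspace_ge) (auto simp: inner_commute)
  moreover have "norm v \<le> norm z" if "(norm v)\<^sup>2 \<le> v \<bullet> z" for z
  proof (cases "v = 0")
    case False
    have "norm v * norm v \<le> norm v * norm z"
      using that norm_cauchy_schwarz[of v z] by (simp add: power2_eq_square)
    with False show ?thesis by simp
  qed simp
  ultimately have "\<forall>z\<in>closure (range (\<lambda>x. x - T x)). norm (0 - v) \<le> norm (0 - z)"
    by auto
  with v show ?thesis
    unfolding infimal_displacement_def projection_def
    by (intro the1_equality infimal_displacement_ex1 T) auto
qed

theorem theorem10:
  fixes x y :: "'i \<Rightarrow> 'a::{real_inner,complete_space}"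
    and I :: "'i set" and C :: "'a set"
  assumes "I \<noteq> {}"
    and "\<And>i j. i \<in> I \<Longrightarrow> j \<in> I \<Longrightarrow> norm (y i - y j) \<le> norm (x i - x j)"
    and "C = closure (convex hull ((\<lambda>i. x i - y i) ` I))"
  shows "(\<exists>T. nonexpansive T \<and> (\<forall>i\<in>I. y i = T (x i)) \<and>
              infimal_displacement T = projection C 0) \<and>
         (\<forall>s\<in>I. \<forall>v. v = x s - y s \<longrightarrow> (\<forall>i\<in>I. (x i - y i) \<bullet> v \<ge> (norm v)\<^sup>2) \<longrightarrow>
              (\<exists>T. nonexpansive T \<and> (\<forall>i\<in>I. y i = T (x i)) \<and>
                   infimal_displacement T = v))"
proof -
  \<comment> \<open>The common core of both parts: \<open>v\<close> may be any element of \<open>C\<close> whose half-space contains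
    the prescribed displacements.\<close>
  have main: "\<exists>T. nonexpansive T \<and> (\<forall>i\<in>I. y i = T (x i)) \<and> infimal_displacement T = v"
    if v: "v \<in> C" and hs: "\<And>i. i \<in> I \<Longrightarrow> (norm v)\<^sup>2 \<le> (x i - y i) \<bullet> v" for v
  proof -
    have "displacement_graph v ((\<lambda>i. (x i, y i)) ` I)"
      using assms(2) hs by (auto simp: displacement_graph_def)
    then obtain T where T: "nonexpansive T" "\<And>i. i \<in> I \<Longrightarrow> T (x i) = y i"
      "\<And>u. (norm v)\<^sup>2 \<le> (u - T u) \<bullet> v"
      by (rule nonexpansive_extension) (simp add: image_iff, metis)
    let ?D = "range (\<lambda>u. u - T u)"
    have "x i - y i \<in> ?D" if "i \<in> I" for i
      using T(2)[OF that] by (intro range_eqI[of _ _ "x i"]) simp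
    then have "(\<lambda>i. x i - y i) ` I \<subseteq> ?D" by blast
    then have "C \<subseteq> closure ?D"
      unfolding assms(3)
      by (intro closure_minimal hull_minimal closure_displacements_convex T(1) closed_closure)
         (use closure_subset in blast)
    with v have "infimal_displacement T = v"
      by (intro infimal_displacement_eqI T) blast
    then show ?thesis
      using T(1,2) by (intro exI[of _ T]) simp
  qed
  have C: "closed C" "convex C" "C \<noteq> {}"
    using assms(1,3) by (auto intro: convex_closure)
  have inC: "x i - y i \<in> C" if "i \<in> I" for i
    unfolding assms(3) using that by (meson closure_subset hull_inc imageI subsetD)
  have proj: "projection C 0 \<in> C \<and> (\<forall>z\<in>C. norm (0 - projection C 0) \<le> norm (0 - z))"
    unfolding projection_def by (rule theI'[OF projection_ex1[OF C]])
  have "(norm (projection C 0))\<^sup>2 \<le> (x i - y i) \<bullet> projection C 0" if "i \<in> I" for i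
    using any_closest_point_dot[of C "projection C 0" "x i - y i" 0] proj C inC[OF that]
    by (simp add: dist_norm inner_diff inner_commute power2_norm_eq_inner)
  with proj show ?thesis
    using main inC by blast
qed

end
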